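(* Let $R>0$, let $u:B(0,R)\to\mathbb C$ be a holomorphic function and fix $0\le\alpha<1$, $0\le\beta\le1$. Assume that $u\in L^{2,\infty}_{\log^\beta}(B(0,R))$. Then $u\in L^2(B(0,\alpha R))$ and there exists a universal constant $\Gamma_0$ (independent of $\alpha$ and $\beta$) such that $$\|u\|_{L^2(B(0,\alpha R))}\le\Gamma_0\,\frac{\alpha}{1-\alpha}\Big(1+\log^\beta\Big(\frac1{1-\alpha}\Big)\Big)\|u\|_{L^{2,\infty}_{\log^\beta}(B(0,R))} .$$
   Context: $B(0,R)$ is the disk of radius $R$ in $\mathbb C$, with Lebesgue measure $\mathscr L^2$. For a measurable $f$ on $B(0,R)$ its decreasing rearrangement is $f_*(t)=\inf\{s>0:\mathscr L^2(\{x\in B(0,R):|f(x)|>s\})\le t\}$. Let $\log^\beta(x)=(\log x)^\beta$, $\log_+=\max(\log,0)$, and $$\Lambda_\beta(t)=\sqrt t\Big(1+\log_+^\beta\Big(R\sqrt{\tfrac{\pi}{t}}\Big)\Big),\qquad t>0 .$$ Then $L^{2,\infty}_{\log^\beta}(B(0,R))$ is the space of $f\in L^1_{\mathrm{loc}}(B(0,R))$ with $$\|f\|_{L^{2,\infty}_{\log^\beta}(B(0,R))}=\sup_{t>0}\Big(\frac1{\Lambda_\beta(t)}\int_0^tf_*(s)\,ds\Big)<\infty ;$$ for $\beta=0$ this is $L^{2,\infty}$ up to equivalence of norms. *)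

theory Defs
  imports "HOL-Complex_Analysis.Complex_Analysis"
begin

text \<open>
  Real powers of nonnegative reals with the usual convention \<open>0\<^sup>0 = 1\<close>; the library's
  \<open>powr\<close> has \<open>0 powr 0 = 0\<close>, which would make a difference for the exponent \<open>\<beta> = 0\<close>.
\<close>
definition rpow :: "real \<Rightarrow> real \<Rightarrow> real" where
  "rpow x \<beta> = (if \<beta> = 0 then 1 else x powr \<beta>)"

definition log_plus :: "real \<Rightarrow> real" where
  "log_plus x = max (ln x) 0"

text \<open>
  The decreasing rearrangement on the disk of radius \<open>R\<close>. It takes values in \<open>ennreal\<close>, so that
  the infimum of the empty set is \<open>\<infinity>\<close>.
\<close>
definition decr_rearr :: "real \<Rightarrow> (complex \<Rightarrow> complex) \<Rightarrow> real \<Rightarrow> ennreal" where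
  "decr_rearr R f t =
     Inf {ennreal s | s. 0 < s \<and> emeasure lebesgue {x \<in> ball 0 R. s < norm (f x)} \<le> ennreal t}"

definition Lambda :: "real \<Rightarrow> real \<Rightarrow> real \<Rightarrow> real" where
  "Lambda R \<beta> t = sqrt t * (1 + rpow (log_plus (R * sqrt (pi / t))) \<beta>)"

definition weak_L2_log_norm :: "real \<Rightarrow> real \<Rightarrow> (complex \<Rightarrow> complex) \<Rightarrow> ennreal" where
  "weak_L2_log_norm R \<beta> f =
     (SUP t\<in>{0<..}. (\<integral>\<^sup>+s\<in>{0<..<t}. decr_rearr R f s \<partial>lborel) / ennreal (Lambda R \<beta> t))"

definition L1_loc :: "complex set \<Rightarrow> (complex \<Rightarrow> complex) set" where
  "L1_loc U = {f. \<forall>K. compact K \<longrightarrow> K \<subseteq> U \<longrightarrow> set_integrable lebesgue K f}"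

definition weak_L2_log :: "real \<Rightarrow> real \<Rightarrow> (complex \<Rightarrow> complex) set" where
  "weak_L2_log R \<beta> = {f \<in> L1_loc (ball 0 R). weak_L2_log_norm R \<beta> f < \<infinity>}"

definition L2_space :: "complex set \<Rightarrow> (complex \<Rightarrow> complex) set" where
  "L2_space A = {f. set_borel_measurable lebesgue A f \<and>
                    set_integrable lebesgue A (\<lambda>x. (norm (f x))\<^sup>2)}"

text \<open>Only meaningful for \<open>f \<in> L2_space A\<close>, since the Bochner integral defaults to \<open>0\<close>.\<close>
definition L2_norm :: "complex set \<Rightarrow> (complex \<Rightarrow> complex) \<Rightarrow> real" where
  "L2_norm A f = sqrt (LINT x:A|lebesgue. (norm (f x))\<^sup>2)"

end

theory Submission imports Defs begin

text \<open>
  The constant \<open>\<Gamma>\<^sub>0 = 1\<close> works, and the \<open>L\<^sup>2\<close> estimate follows from a uniform bound. Let \<open>m\<close> be the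
  weak norm of \<open>u\<close>, let \<open>z\<close> lie in the disk of radius \<open>\<alpha> R\<close>, and put \<open>r = (1 - \<alpha>) R\<close>, so that the disk
  of radius \<open>r\<close> about \<open>z\<close> is contained in \<open>ball 0 R\<close>. The mean value property over this disk
  (\<open>norm_le_disk_mean\<close>), the Hardy-Littlewood inequality (\<open>nn_integral_le_decr_rearr\<close>) and the
  definition of the weak norm, in this order, give

  \<open>\<pi> r\<^sup>2 |u z| \<le> \<integral> |u| over ball z r \<le> \<integral> u\<^sub>* over (0, \<pi> r\<^sup>2) \<le> m * Lambda R \<beta> (\<pi> r\<^sup>2)\<close>.

  The right-hand side equals \<open>m sqrt \<pi> r (1 + log\<^sup>\<beta> (1 / (1 - \<alpha>)))\<close>, so \<open>|u z|\<close> is at most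
  \<open>m (1 + log\<^sup>\<beta> (1 / (1 - \<alpha>))) / (sqrt \<pi> (1 - \<alpha>) R)\<close> (\<open>holomorphic_bound_weak_L2_log\<close>). The square root of
  the area of the disk of radius \<open>\<alpha> R\<close> is \<open>sqrt \<pi> \<alpha> R\<close>, and multiplying by it gives exactly the claim.

  The area mean value property is obtained from Cauchy's formula on circles by averaging over
  rotations, which needs the invariance of Lebesgue measure under orthogonal maps
  (\<open>nn_integral_lborel_orthogonal\<close>).
\<close>

section \<open>Invariance of Lebesgue measure under orthogonal maps\<close>

lemma nn_integral_lborel_translate:
  fixes a :: "'a::euclidean_space"
  assumes [measurable]: "f \<in> borel_measurable borel"
  shows "(\<integral>\<^sup>+x. f (a + x) \<partial>lborel) = (\<integral>\<^sup>+x. f x \<partial>lborel)"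
  using nn_integral_distr[of "(+) a" lborel borel f] by (simp add: lborel_distr_plus)

text \<open>
  The argument is the one for uniqueness of Haar measure. With \<open>B\<close> the unit ball, the double
  integral of \<open>indicator A (T x + y) * indicator B y\<close> is computed in both orders. Writing
  \<open>y = T y'\<close> and translating in \<open>x\<close> gives \<open>|T -` A| |B|\<close>; translating in \<open>y\<close> first, and using
  that \<open>B\<close> is symmetric and \<open>T\<close>-invariant, gives \<open>|A| |B|\<close>. As \<open>0 < |B| < \<infinity>\<close>, the factor cancels.
\<close>
lemma emeasure_lborel_orthogonal_vimage:
  fixes T :: "'a::euclidean_space \<Rightarrow> 'a"
  assumes T: "orthogonal_transformation T" and A [measurable]: "A \<in> sets borel"
  shows "emeasure lborel (T -` A) = emeasure lborel A"
proof -
  define B where "B = ball (0::'a) 1"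
  have [measurable]: "B \<in> sets borel" by (simp add: B_def)
  have lin: "linear T" using T by (rule orthogonal_transformation_linear)
  have [measurable]: "T \<in> borel_measurable borel"
    using lin by (intro borel_measurable_continuous_onI linear_continuous_on linear_conv_bounded_linear[THEN iffD1])
  have [measurable]: "T -` A \<in> sets borel"
    using measurable_sets_borel[of T borel A] by simp
  have [simp]: "indicator B (T x) = (indicator B x :: ennreal)" for x
    using T by (simp add: B_def indicator_def orthogonal_transformation_norm)
  have inner1: "(\<integral>\<^sup>+x. indicator A (T x + y) * indicator B y \<partial>lborel)
      = emeasure lborel (T -` A) * indicator B y" for y
  proof -
    obtain y' where y': "y = T y'"
      using orthogonal_transformation_surj[OF T] by (metis surjD)
    have "(\<integral>\<^sup>+x. indicator A (T x + y) \<partial>lborel) = (\<integral>\<^sup>+x. indicator (T -` A) (y' + x) \<partial>lborel)"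
      by (simp add: y' linear_add[OF lin] indicator_def add.commute)
    also have "\<dots> = emeasure lborel (T -` A)"
      by (subst nn_integral_lborel_translate) auto
    finally show ?thesis by (simp add: nn_integral_multc)
  qed
  have inner2: "(\<integral>\<^sup>+y. indicator A (T x + y) * indicator B y \<partial>lborel)
      = (\<integral>\<^sup>+y. indicator A y * indicator B (y - T x) \<partial>lborel)" for x
    using nn_integral_lborel_translate[of "\<lambda>y. indicator A y * indicator B (y - T x)" "T x"] by simp
  have inner3: "(\<integral>\<^sup>+x. indicator A y * indicator B (y - T x) \<partial>lborel)
      = indicator A y * emeasure lborel B" for y
  proof -
    obtain y' where y': "y = T y'"
      using orthogonal_transformation_surj[OF T] by (metis surjD)
    have "(\<integral>\<^sup>+x. indicator B (y - T x) \<partial>lborel) = (\<integral>\<^sup>+x. indicator B (y' - x) \<partial>lborel)"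
      by (simp add: y' flip: linear_diff[OF lin])
    also have "\<dots> = (\<integral>\<^sup>+x. indicator B (- y' + x) \<partial>lborel)"
      by (intro nn_integral_cong) (simp add: B_def indicator_def norm_minus_commute)
    also have "\<dots> = emeasure lborel B"
      by (subst nn_integral_lborel_translate) auto
    finally show ?thesis by (simp add: nn_integral_cmult)
  qed
  have "emeasure lborel (T -` A) * emeasure lborel B
      = (\<integral>\<^sup>+y. \<integral>\<^sup>+x. indicator A (T x + y) * indicator B y \<partial>lborel \<partial>lborel)"
    by (simp add: inner1 nn_integral_cmult)
  also have "\<dots> = (\<integral>\<^sup>+x. \<integral>\<^sup>+y. indicator A (T x + y) * indicator B y \<partial>lborel \<partial>lborel)"
    by (rule lborel_pair.Fubini') measurable
  also have "\<dots> = (\<integral>\<^sup>+x. \<integral>\<^sup>+y. indicator A y * indicator B (y - T x) \<partial>lborel \<partial>lborel)"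
    by (simp only: inner2)
  also have "\<dots> = (\<integral>\<^sup>+y. \<integral>\<^sup>+x. indicator A y * indicator B (y - T x) \<partial>lborel \<partial>lborel)"
    by (rule lborel_pair.Fubini') measurable
  also have "\<dots> = emeasure lborel A * emeasure lborel B"
    by (simp add: inner3 nn_integral_multc)
  finally have "emeasure lborel B * emeasure lborel (T -` A) = emeasure lborel B * emeasure lborel A"
    by (simp add: mult.commute)
  moreover have "emeasure lborel B = ennreal (unit_ball_vol DIM('a))"
    by (simp add: B_def emeasure_ball)
  moreover have "\<not> unit_ball_vol (real DIM('a)) \<le> 0"
    by (simp add: not_le)
  ultimately show ?thesis
    by (auto simp: ennreal_mult_cancel_left ennreal_eq_0_iff)
qed

lemma nn_integral_lborel_orthogonal:
  fixes T :: "'a::euclidean_space \<Rightarrow> 'a"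
  assumes T: "orthogonal_transformation T" and f [measurable]: "f \<in> borel_measurable borel"
  shows "(\<integral>\<^sup>+x. f (T x) \<partial>lborel) = (\<integral>\<^sup>+x. f x \<partial>lborel)"
proof -
  have [measurable]: "T \<in> borel_measurable borel"
    using orthogonal_transformation_linear[OF T]
    by (intro borel_measurable_continuous_onI linear_continuous_on linear_conv_bounded_linear[THEN iffD1])
  have "distr lborel borel T = lborel"
    by (rule measure_eqI) (auto simp: emeasure_distr emeasure_lborel_orthogonal_vimage[OF T])
  then show ?thesis
    using nn_integral_distr[of T lborel borel f] by simp
qed

section \<open>The area mean value inequality\<close>

text \<open>
  This is Cauchy's formula at the centre of the unit circle, stated with a nonnegative integral so
  that it can be averaged further by Tonelli's theorem without integrability conditions.
\<close>
lemma norm_le_circle_mean: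
  assumes "g holomorphic_on cball 0 1"
  shows "ennreal (2 * pi * norm (g 0))
    \<le> (\<integral>\<^sup>+t. indicator {0..2*pi} t * ennreal (norm (g (cis t))) \<partial>lborel)"
proof -
  have "((\<lambda>w. g w / (w - 0)) has_contour_integral 2 * of_real pi * \<i> * g 0) (circlepath 0 1)"
    using assms by (intro Cauchy_integral_circlepath_simple) auto
  then have "((\<lambda>t. \<i> * g (cis t)) has_integral 2 * of_real pi * \<i> * g 0) {0..2*pi}"
    by (simp add: circlepath_def has_contour_integral_part_circlepath_iff mult.commute)
  from has_integral_mult_right[OF this, of "-\<i>"]
  have int: "((\<lambda>t. g (cis t)) has_integral 2 * of_real pi * g 0) {0..2*pi}"
    by (simp add: mult_ac)
  have cont: "continuous_on {0..2*pi} (\<lambda>t. norm (g (cis t)))"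
    by (intro continuous_intros continuous_on_compose2[OF holomorphic_on_imp_continuous_on[OF assms]]) auto
  then have int': "(\<lambda>t. norm (g (cis t))) integrable_on {0..2*pi}"
    by (rule integrable_continuous_real)
  have "2 * pi * norm (g 0) = norm (integral {0..2*pi} (\<lambda>t. g (cis t)))"
    using int by (simp add: integral_unique norm_mult)
  also have "\<dots> \<le> integral {0..2*pi} (\<lambda>t. norm (g (cis t)))"
    using int int' by (intro integral_norm_bound_integral) auto
  finally have "ennreal (2 * pi * norm (g 0)) \<le> ennreal (integral {0..2*pi} (\<lambda>t. norm (g (cis t))))"
    by (rule ennreal_leI)
  also have "\<dots> = (\<integral>\<^sup>+t. indicator {0..2*pi} t * ennreal (norm (g (cis t))) \<partial>lborel)"
    using nn_integral_has_integral_lebesgue[OF _ integrable_integral[OF int']]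
    by (simp add: ennreal_mult' ennreal_indicator)
  finally show ?thesis .
qed

text \<open>
  For each \<open>w\<close> with \<open>norm w < r\<close> the circle mean value inequality bounds
  \<open>norm (f z)\<close> by the average of \<open>norm (f (z + cis t * w))\<close> over the angle \<open>t\<close>. Integrating in \<open>w\<close>
  and exchanging the integrals, the inner integral over \<open>w\<close> is the same for every \<open>t\<close>, as
  rotations preserve area. This replaces integration in polar coordinates.
\<close>
lemma norm_le_disk_mean:
  assumes hol: "f holomorphic_on ball z r"
  shows "emeasure lborel (ball z r) * ennreal (norm (f z))
    \<le> (\<integral>\<^sup>+x. indicator (ball z r) x * ennreal (norm (f x)) \<partial>lborel)"
proof -
  \<comment> \<open>Extension by zero makes the integrand Borel on the whole plane, where translations and
    rotations act.\<close>
  define v where "v w = ennreal (norm (indicator (ball z r) w *\<^sub>R f w))" for w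
  have [measurable]: "(\<lambda>w. indicator (ball z r) w *\<^sub>R f w) \<in> borel_measurable borel"
    using hol by (intro borel_measurable_continuous_on_indicator holomorphic_on_imp_continuous_on) auto
  have v [measurable]: "v \<in> borel_measurable borel"
    unfolding v_def by measurable
  have v_eq: "v w = indicator (ball z r) w * ennreal (norm (f w))" for w
    by (simp add: v_def indicator_def)
  have orth: "orthogonal_transformation ((*) (cis t))" for t
    unfolding orthogonal_transformation by (simp add: norm_mult bounded_linear_mult_right bounded_linear.linear)
  have cis: "cis \<in> borel_measurable borel"
    by (intro borel_measurable_continuous_onI continuous_intros)
  note [measurable] = cis
  let ?I = "indicator {0..2*pi} :: real \<Rightarrow> ennreal"
  have circle: "ennreal (2 * pi * norm (f z)) * indicator (ball z r) (z + w)
      \<le> (\<integral>\<^sup>+t. ?I t * v (z + cis t * w) \<partial>lborel)" for w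
  proof (cases "norm w < r")
    case True
    have in_ball: "z + \<zeta> * w \<in> ball z r" if "norm \<zeta> \<le> 1" for \<zeta>
    proof -
      have "norm (\<zeta> * w) \<le> norm w"
        using that by (simp add: norm_mult mult_left_le_one_le)
      with True show ?thesis by (simp add: dist_norm)
    qed
    have "(\<lambda>\<zeta>. f (z + \<zeta> * w)) holomorphic_on cball 0 1"
      using in_ball
      by (intro holomorphic_on_compose_gen[OF _ hol, of "\<lambda>\<zeta>. z + \<zeta> * w", unfolded o_def] holomorphic_intros) auto
    from norm_le_circle_mean[OF this] show ?thesis
      using True in_ball by (simp add: v_eq dist_norm)
  next
    case False
    then show ?thesis by (simp add: dist_norm)
  qed
  have translate: "(\<integral>\<^sup>+w. g (z + w) \<partial>lborel) = (\<integral>\<^sup>+w. g w \<partial>lborel)"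
    if "g \<in> borel_measurable borel" for g :: "complex \<Rightarrow> ennreal"
    using that by (rule nn_integral_lborel_translate)
  have rotate: "(\<integral>\<^sup>+w. v (z + cis t * w) \<partial>lborel) = (\<integral>\<^sup>+w. v w \<partial>lborel)" for t
    using nn_integral_lborel_orthogonal[OF orth[of t], of "\<lambda>w. v (z + w)"] translate[OF v] by simp
  have "ennreal (2 * pi) * (emeasure lborel (ball z r) * ennreal (norm (f z)))
      = ennreal (2 * pi * norm (f z)) * emeasure lborel (ball z r)"
    by (simp add: ennreal_mult mult_ac)
  also have "\<dots> = (\<integral>\<^sup>+w. ennreal (2 * pi * norm (f z)) * indicator (ball z r) (z + w) \<partial>lborel)"
  proof (subst nn_integral_cmult)
    show "(\<lambda>w. indicator (ball z r) (z + w)) \<in> borel_measurable lborel"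
      by (rule measurable_compose[of "(+) z" _ borel]) (simp_all add: borel_measurable_indicator)
  next
    have "(\<integral>\<^sup>+w. indicator (ball z r) (z + w) \<partial>lborel) = emeasure lborel (ball z r)"
      by (subst translate) (simp_all add: borel_measurable_indicator)
    then show "ennreal (2 * pi * norm (f z)) * emeasure lborel (ball z r)
        = ennreal (2 * pi * norm (f z)) * (\<integral>\<^sup>+w. indicator (ball z r) (z + w) \<partial>lborel)"
      by simp
  qed
  also have "\<dots> \<le> (\<integral>\<^sup>+w. \<integral>\<^sup>+t. ?I t * v (z + cis t * w) \<partial>lborel \<partial>lborel)"
    by (rule nn_integral_mono) (rule circle)
  also have "\<dots> = (\<integral>\<^sup>+t. \<integral>\<^sup>+w. ?I t * v (z + cis t * w) \<partial>lborel \<partial>lborel)"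
  proof (rule lborel_pair.Fubini')
    have [measurable]: "(\<lambda>(w, t). z + cis t * w) \<in> borel_measurable (lborel \<Otimes>\<^sub>M lborel)"
      unfolding lborel_prod
      by (simp add: split_beta' borel_measurable_continuous_onI continuous_intros)
    have [measurable]: "(\<lambda>(w, t). v (z + cis t * w)) \<in> borel_measurable (lborel \<Otimes>\<^sub>M lborel)"
      using measurable_compose[OF \<open>(\<lambda>(w, t). z + cis t * w) \<in> _\<close> v] by (simp add: split_beta')
    show "(\<lambda>(t, w). ?I t * v (z + cis t * w)) \<in> borel_measurable (lborel \<Otimes>\<^sub>M lborel)"
      by measurable
  qed
  also have "\<dots> = (\<integral>\<^sup>+t. ?I t * (\<integral>\<^sup>+w. v w \<partial>lborel) \<partial>lborel)"
  proof (rule nn_integral_cong)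
    fix t :: real
    have "(\<lambda>w. v (z + cis t * w)) \<in> borel_measurable lborel"
      by (rule measurable_compose[OF _ v]) simp
    then show "(\<integral>\<^sup>+w. ?I t * v (z + cis t * w) \<partial>lborel) = ?I t * (\<integral>\<^sup>+w. v w \<partial>lborel)"
      by (simp only: nn_integral_cmult rotate)
  qed
  also have "\<dots> = ennreal (2 * pi) * (\<integral>\<^sup>+w. v w \<partial>lborel)"
    by (subst nn_integral_multc) simp_all
  finally show ?thesis
    unfolding v_eq by (rule ennreal_mult_le_mult_iff[THEN iffD1, rotated 2]) simp_all
qed

section \<open>Integrals over sets and the decreasing rearrangement\<close>

text \<open>
  The Hardy-Littlewood inequality for the indicator of a set, by the layer-cake formula. Let
  \<open>m s\<close> be the area of \<open>{norm f > s}\<close>. The part of this level set inside \<open>A\<close> has area at most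
  \<open>min |A| (m s)\<close>, which is the length of \<open>{t. 0 < t < |A| \<and> t < m s}\<close>. Integrating
  over \<open>s > 0\<close> gives \<open>\<integral>\<^sub>A norm f\<close> on the left. On the right, exchanging the integrals leaves, for each
  \<open>t < |A|\<close>, the length of \<open>{s > 0. t < m s}\<close>, which the rearrangement at \<open>t\<close> dominates.
\<close>
lemma nn_integral_le_decr_rearr:
  fixes f :: "complex \<Rightarrow> complex"
  assumes f: "set_borel_measurable borel (ball 0 R) f"
    and A [measurable]: "A \<in> sets borel" and AR: "A \<subseteq> ball 0 R"
  shows "(\<integral>\<^sup>+x. indicator A x * ennreal (norm (f x)) \<partial>lborel)
    \<le> (\<integral>\<^sup>+t\<in>{0<..<measure lborel A}. decr_rearr R f t \<partial>lborel)"
proof -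
  define a where "a = measure lborel A"
  define g where "g x = norm (indicator (ball 0 R) x *\<^sub>R f x)" for x
  have g [measurable]: "g \<in> borel_measurable borel"
    using f unfolding g_def set_borel_measurable_def by measurable
  define E where "E s = {x \<in> ball 0 R. s < norm (f x)}" for s
  have E_eq: "E s = {x. x \<in> ball 0 R \<and> s < g x}" for s
    by (auto simp: E_def g_def)
  have E_sets [measurable]: "E s \<in> sets borel" for s
  proof -
    have "E s = ball 0 R \<inter> {x. s < g x}"
      by (auto simp: E_eq)
    moreover have "{x. s < g x} \<in> sets borel"
      using measurable_sets_borel[OF g, of "{s<..}"] by (simp add: vimage_def)
    ultimately show ?thesis by simp
  qed
  \<comment> \<open>The distribution function is real-valued because the disk has finite area.\<close>
  have fin: "emeasure lborel B < \<infinity>" if "B \<subseteq> ball 0 R" for B :: "complex set"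
    using that by (intro emeasure_bounded_finite) (auto intro: bounded_subset)
  define m where "m s = measure lborel (E s)" for s
  have m_eq: "emeasure lborel (E s) = ennreal (m s)" for s
    unfolding m_def using fin[of "E s"] by (intro emeasure_eq_ennreal_measure) (force simp: E_def)
  have a_eq: "emeasure lborel A = ennreal a"
    unfolding a_def using fin[OF AR] by (intro emeasure_eq_ennreal_measure) auto
  have m_nonneg: "0 \<le> m s" for s by (simp add: m_def)
  have a_nonneg: "0 \<le> a" by (simp add: a_def)
  have "mono (\<lambda>s. - m s)"
  proof (rule monoI)
    fix s s' :: real assume "s \<le> s'"
    then have "emeasure lborel (E s') \<le> emeasure lborel (E s)"
      using E_sets by (intro emeasure_mono) (auto simp: E_def[abs_def] simp del: mem_ball)
    then show "- m s \<le> - m s'"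
      using m_nonneg by (simp add: m_eq)
  qed
  then have "(\<lambda>s. - (- m s)) \<in> borel_measurable borel"
    by (intro borel_measurable_uminus borel_measurable_mono)
  then have [measurable]: "m \<in> borel_measurable borel" by simp

  \<comment> \<open>Every \<open>s0\<close> admissible in the infimum defining the rearrangement satisfies \<open>m s0 \<le> t\<close>,
    so by monotonicity the levels \<open>s\<close> with \<open>t < m s\<close> all lie below it.\<close>
  have below_rearr: "(\<integral>\<^sup>+s. indicator {s. 0 < s \<and> t < m s} s \<partial>lborel) \<le> decr_rearr R f t"
    if "0 \<le> t" for t
    unfolding decr_rearr_def
  proof (rule Inf_greatest, clarify)
    fix s0 :: real
    assume "0 < s0" and "emeasure lebesgue {x \<in> ball 0 R. s0 < norm (f x)} \<le> ennreal t"
    then have "ennreal (m s0) \<le> ennreal t"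
      unfolding E_def[symmetric] by (simp add: m_eq)
    then have "m s0 \<le> t" using \<open>0 \<le> t\<close> by simp
    have "s \<in> {0<..<s0}" if "0 < s" "t < m s" for s
    proof -
      have "\<not> s0 \<le> s"
        using \<open>mono (\<lambda>s. - m s)\<close> \<open>m s0 \<le> t\<close> that by (auto dest: monoD[of _ s0 s])
      with that show ?thesis by simp
    qed
    then have "(\<integral>\<^sup>+s. indicator {s. 0 < s \<and> t < m s} s \<partial>lborel)
        \<le> (\<integral>\<^sup>+s. indicator {0<..<s0} s \<partial>lborel)"
      by (intro nn_integral_mono) (auto simp: indicator_def)
    also have "\<dots> = ennreal s0" using \<open>0 < s0\<close> by simp
    finally show "(\<integral>\<^sup>+s. indicator {s. 0 < s \<and> t < m s} s \<partial>lborel) \<le> ennreal s0" .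
  qed

  have level_sets: "(\<integral>\<^sup>+x. indicator A x * indicator {0<..<g x} s \<partial>lborel)
      \<le> (\<integral>\<^sup>+t. indicator {0<..<a} t * indicator {s. 0 < s \<and> t < m s} s \<partial>lborel)" for s :: real
  proof (cases "0 < s")
    case True
    have "(\<integral>\<^sup>+x. indicator A x * indicator {0<..<g x} s \<partial>lborel) = (\<integral>\<^sup>+x. indicator (A \<inter> E s) x \<partial>lborel)"
      using True AR by (intro nn_integral_cong) (auto simp: indicator_def E_eq)
    also have "\<dots> = emeasure lborel (A \<inter> E s)" by simp
    also have "\<dots> \<le> min (emeasure lborel A) (emeasure lborel (E s))"
      by (simp add: emeasure_mono)
    also have "\<dots> = ennreal (min a (m s))"
      by (simp add: a_eq m_eq a_nonneg m_nonneg min_def)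
    also have "\<dots> = (\<integral>\<^sup>+t. indicator {0<..<min a (m s)} t \<partial>lborel)"
      using a_nonneg m_nonneg by simp
    also have "\<dots> \<le> (\<integral>\<^sup>+t. indicator {0<..<a} t * indicator {s. 0 < s \<and> t < m s} s \<partial>lborel)"
      using True by (intro nn_integral_mono) (auto simp: indicator_def)
    finally show ?thesis .
  qed (auto simp: indicator_def)

  have "(\<integral>\<^sup>+x. indicator A x * ennreal (norm (f x)) \<partial>lborel)
      = (\<integral>\<^sup>+x. \<integral>\<^sup>+s. indicator A x * indicator {0<..<g x} s \<partial>lborel \<partial>lborel)"
  proof (rule nn_integral_cong)
    fix x
    have "0 \<le> g x" by (simp add: g_def)
    then have "(\<integral>\<^sup>+s. indicator A x * indicator {0<..<g x} s \<partial>lborel) = indicator A x * ennreal (g x)"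
      by (subst nn_integral_cmult) simp_all
    also have "\<dots> = indicator A x * ennreal (norm (f x))"
      using AR by (auto simp: g_def indicator_def)
    finally show "indicator A x * ennreal (norm (f x))
        = (\<integral>\<^sup>+s. indicator A x * indicator {0<..<g x} s \<partial>lborel)" ..
  qed
  also have "\<dots> = (\<integral>\<^sup>+s. \<integral>\<^sup>+x. indicator A x * indicator {0<..<g x} s \<partial>lborel \<partial>lborel)"
    unfolding indicator_def greaterThanLessThan_iff by (rule lborel_pair.Fubini') measurable
  also have "\<dots> \<le> (\<integral>\<^sup>+s. \<integral>\<^sup>+t. indicator {0<..<a} t * indicator {s. 0 < s \<and> t < m s} s \<partial>lborel \<partial>lborel)"
    by (rule nn_integral_mono) (rule level_sets)
  also have "\<dots> = (\<integral>\<^sup>+t. \<integral>\<^sup>+s. indicator {0<..<a} t * indicator {s. 0 < s \<and> t < m s} s \<partial>lborel \<partial>lborel)"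
    unfolding indicator_def greaterThanLessThan_iff mem_Collect_eq by (rule lborel_pair.Fubini') measurable
  also have "\<dots> = (\<integral>\<^sup>+t. indicator {0<..<a} t * (\<integral>\<^sup>+s. indicator {s. 0 < s \<and> t < m s} s \<partial>lborel) \<partial>lborel)"
    by (intro nn_integral_cong nn_integral_cmult) measurable
  also have "\<dots> \<le> (\<integral>\<^sup>+t. decr_rearr R f t * indicator {0<..<a} t \<partial>lborel)"
  proof (rule nn_integral_mono)
    fix t
    show "indicator {0<..<a} t * (\<integral>\<^sup>+s. indicator {s. 0 < s \<and> t < m s} s \<partial>lborel)
        \<le> decr_rearr R f t * indicator {0<..<a} t"
      using below_rearr[of t] by (cases "t \<in> {0<..<a}") simp_all
  qed
  finally show ?thesis by (simp add: a_def)
qed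

lemma nn_integral_decr_rearr_le:
  assumes "0 < t"
  shows "(\<integral>\<^sup>+s\<in>{0<..<t}. decr_rearr R f s \<partial>lborel)
    \<le> ennreal (Lambda R \<beta> t) * weak_L2_log_norm R \<beta> f"
proof -
  have "0 < Lambda R \<beta> t"
    using assms by (auto simp: Lambda_def rpow_def intro!: mult_pos_pos add_pos_nonneg)
  moreover have "(\<integral>\<^sup>+s\<in>{0<..<t}. decr_rearr R f s \<partial>lborel) / ennreal (Lambda R \<beta> t)
      \<le> weak_L2_log_norm R \<beta> f"
    unfolding weak_L2_log_norm_def using assms by (intro SUP_upper) auto
  moreover have "x = ennreal c * (x / ennreal c)" if "0 < c" for x c
    using that by (simp add: ennreal_times_divide mult_divide_eq_ennreal mult.commute[of "ennreal c"])
  ultimately show ?thesis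
    by (metis mult_left_mono zero_le)
qed

section \<open>The uniform bound\<close>

text \<open>
  The disk of radius \<open>r = (1 - \<alpha>) R\<close> about \<open>z\<close> stays inside \<open>ball 0 R\<close>. For \<open>t = \<pi> r\<^sup>2\<close>, its area,
  the argument \<open>R sqrt (\<pi> / t)\<close> of the logarithm in \<^const>\<open>Lambda\<close> becomes \<open>R / r = 1 / (1 - \<alpha>)\<close>. Hence
  the mean of \<open>norm u\<close> over this disk is at most \<open>m * Lambda R \<beta> t / t\<close>, which is the stated bound.
\<close>
lemma holomorphic_bound_weak_L2_log:
  assumes R: "0 < R" and hol: "u holomorphic_on ball 0 R" and \<alpha>: "\<alpha> < 1"
    and z: "norm z \<le> \<alpha> * R" and m: "weak_L2_log_norm R \<beta> u = ennreal m" "0 \<le> m"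
  shows "norm (u z) \<le> m * (1 + rpow (ln (1 / (1 - \<alpha>))) \<beta>) / (sqrt pi * ((1 - \<alpha>) * R))"
proof -
  define r where "r = (1 - \<alpha>) * R"
  define K where "K = 1 + rpow (ln (1 / (1 - \<alpha>))) \<beta>"
  have "0 \<le> \<alpha>"
    using order_trans[OF norm_ge_zero z] R by (simp add: zero_le_mult_iff)
  have r: "0 < r" using R \<alpha> by (simp add: r_def)
  have sub: "ball z r \<subseteq> ball 0 R"
  proof
    fix x assume "x \<in> ball z r"
    then have "norm x < \<alpha> * R + r"
      using z norm_triangle_ineq2[of x z] by (simp add: dist_norm norm_minus_commute)
    then show "x \<in> ball 0 R" by (simp add: r_def algebra_simps)
  qed
  have vol: "measure lborel (ball z r) = pi * r\<^sup>2" "emeasure lborel (ball z r) = ennreal (pi * r\<^sup>2)"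
    using r by (simp_all add: content_ball emeasure_ball unit_ball_vol_2)
  have "sqrt (pi / (pi * r\<^sup>2)) = 1 / r"
    using r by (simp add: real_sqrt_divide)
  moreover have "0 \<le> ln (1 / (1 - \<alpha>))"
    using \<alpha> \<open>0 \<le> \<alpha>\<close> by (simp add: ln_div ln_le_zero_iff)
  ultimately have Lam: "Lambda R \<beta> (pi * r\<^sup>2) = sqrt pi * r * K"
    using R r by (simp add: Lambda_def log_plus_def K_def real_sqrt_mult r_def max_def)
  have "set_borel_measurable borel (ball 0 R) u"
    using hol by (intro set_measurable_continuous_on holomorphic_on_imp_continuous_on) auto
  then have "emeasure lborel (ball z r) * ennreal (norm (u z))
      \<le> (\<integral>\<^sup>+t\<in>{0<..<measure lborel (ball z r)}. decr_rearr R u t \<partial>lborel)"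
    using sub by (intro order_trans[OF norm_le_disk_mean nn_integral_le_decr_rearr] holomorphic_on_subset[OF hol]) auto
  also have "\<dots> \<le> ennreal (sqrt pi * r * K) * ennreal m"
    using nn_integral_decr_rearr_le[of "pi * r\<^sup>2" R u \<beta>] r by (simp add: vol m Lam)
  finally have "ennreal (pi * r\<^sup>2 * norm (u z)) \<le> ennreal (sqrt pi * r * K * m)"
    using m r by (simp add: vol ennreal_mult'')
  moreover have "0 \<le> K" by (auto simp: K_def rpow_def)
  ultimately have "(sqrt pi)\<^sup>2 * r\<^sup>2 * norm (u z) \<le> sqrt pi * r * K * m"
    using m r by simp
  then have "(sqrt pi * r) * (sqrt pi * r * norm (u z)) \<le> (sqrt pi * r) * (m * K)"
    by (simp only: power2_eq_square mult_ac)
  then have "sqrt pi * r * norm (u z) \<le> m * K"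
    using r by (subst (asm) mult_le_cancel_left_pos) auto
  then show ?thesis
    unfolding K_def[symmetric] r_def[symmetric]
    using r by (simp add: pos_le_divide_eq mult_ac)
qed

section \<open>The square-integral estimate\<close>

lemma L2_norm_le_of_bounded:
  fixes f :: "complex \<Rightarrow> complex"
  assumes \<rho>: "0 \<le> \<rho>" and f: "continuous_on (ball z \<rho>) f"
    and bound: "\<And>x. x \<in> ball z \<rho> \<Longrightarrow> norm (f x) \<le> C" and C: "0 \<le> C"
  shows "f \<in> L2_space (ball z \<rho>)" "L2_norm (ball z \<rho>) f \<le> C * (sqrt pi * \<rho>)"
proof -
  have meas: "set_borel_measurable lebesgue (ball z \<rho>) h"
    if "continuous_on (ball z \<rho>) h" for h :: "complex \<Rightarrow> 'a::real_normed_vector"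
    using set_measurable_continuous_on[OF _ that]
    by (simp add: set_borel_measurable_def measurable_completion)
  note meas_f = meas[OF f] and meas_sq = meas[OF continuous_on_power[OF continuous_on_norm[OF f]], of 2]
  have int: "set_integrable lebesgue (ball z \<rho>) (\<lambda>x. (norm (f x))\<^sup>2)"
    unfolding set_integrable_def
  proof (rule integrableI_bounded_set[where A = "ball z \<rho>" and B = "C\<^sup>2"])
    show "(\<lambda>x. indicat_real (ball z \<rho>) x *\<^sub>R (norm (f x))\<^sup>2) \<in> borel_measurable lebesgue"
      using meas_sq by (simp add: set_borel_measurable_def)
    show "emeasure lebesgue (ball z \<rho>) < \<infinity>"
      using \<rho> by (simp add: emeasure_ball)
    show "AE x\<in>ball z \<rho> in lebesgue. norm (indicat_real (ball z \<rho>) x *\<^sub>R (norm (f x))\<^sup>2) \<le> C\<^sup>2"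
      using bound by (intro AE_I2) (auto intro!: power_mono)
  qed auto
  with meas_f show "f \<in> L2_space (ball z \<rho>)" by (simp add: L2_space_def)
  have "(LINT x:ball z \<rho>|lebesgue. (norm (f x))\<^sup>2) \<le> (LINT x:ball z \<rho>|lebesgue. C\<^sup>2)"
    using int bound \<rho>
    by (intro set_integral_mono) (auto intro!: power_mono simp: set_integrable_def emeasure_ball)
  also have "\<dots> = (C * (sqrt pi * \<rho>))\<^sup>2"
    using \<rho> by (simp add: set_lebesgue_integral_def content_ball unit_ball_vol_2 power_mult_distrib)
  finally show "L2_norm (ball z \<rho>) f \<le> C * (sqrt pi * \<rho>)"
    unfolding L2_norm_def using \<rho> C by (intro real_le_lsqrt) auto
qed

theorem lemma3p10:
  "\<exists>\<Gamma>0 > (0::real).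
     \<forall>(R::real) (u :: complex \<Rightarrow> complex) (\<alpha>::real) (\<beta>::real).
       0 < R \<longrightarrow> u holomorphic_on ball 0 R \<longrightarrow>
       0 \<le> \<alpha> \<longrightarrow> \<alpha> < 1 \<longrightarrow> 0 \<le> \<beta> \<longrightarrow> \<beta> \<le> 1 \<longrightarrow>
       u \<in> weak_L2_log R \<beta> \<longrightarrow>
         u \<in> L2_space (ball 0 (\<alpha> * R)) \<and>
         ennreal (L2_norm (ball 0 (\<alpha> * R)) u)
           \<le> ennreal (\<Gamma>0 * (\<alpha> / (1 - \<alpha>)) * (1 + rpow (ln (1 / (1 - \<alpha>))) \<beta>))
              * weak_L2_log_norm R \<beta> u"
proof (intro exI[of _ "1::real"] conjI[OF zero_less_one] allI impI)
  fix R :: real and u :: "complex \<Rightarrow> complex" and \<alpha> \<beta> :: real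
  assume R: "0 < R" and hol: "u holomorphic_on ball 0 R" and \<alpha>: "0 \<le> \<alpha>" "\<alpha> < 1"
    and u: "u \<in> weak_L2_log R \<beta>"
  define K where "K = 1 + rpow (ln (1 / (1 - \<alpha>))) \<beta>"
  have K: "0 \<le> K" by (auto simp: K_def rpow_def)
  obtain m where m: "weak_L2_log_norm R \<beta> u = ennreal m" "0 \<le> m"
    using u by (cases "weak_L2_log_norm R \<beta> u") (auto simp: weak_L2_log_def)
  define C where "C = m * K / (sqrt pi * ((1 - \<alpha>) * R))"
  have C: "0 \<le> C" using m K R \<alpha> by (simp add: C_def)
  have \<rho>: "0 \<le> \<alpha> * R" "\<alpha> * R \<le> R" using R \<alpha> by (auto simp: mult_left_le_one_le)
  have cont: "continuous_on (ball 0 (\<alpha> * R)) u"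
    using hol \<rho> by (intro continuous_on_subset[OF holomorphic_on_imp_continuous_on]) auto
  have bound: "norm (u z) \<le> C" if "z \<in> ball 0 (\<alpha> * R)" for z
    unfolding C_def K_def using R hol \<alpha>(2) _ m
    by (rule holomorphic_bound_weak_L2_log) (use that in simp)
  note L2 = L2_norm_le_of_bounded[OF \<rho>(1) cont bound C]
  have "C * (sqrt pi * (\<alpha> * R)) = 1 * (\<alpha> / (1 - \<alpha>)) * K * m"
    using R \<alpha> by (simp add: C_def)
  with L2 have "ennreal (L2_norm (ball 0 (\<alpha> * R)) u) \<le> ennreal (1 * (\<alpha> / (1 - \<alpha>)) * K) * ennreal m"
    using m by (metis ennreal_leI ennreal_mult'')
  with L2 show "u \<in> L2_space (ball 0 (\<alpha> * R)) \<and>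
         ennreal (L2_norm (ball 0 (\<alpha> * R)) u)
           \<le> ennreal (1 * (\<alpha> / (1 - \<alpha>)) * (1 + rpow (ln (1 / (1 - \<alpha>))) \<beta>))
              * weak_L2_log_norm R \<beta> u"
    by (simp only: m K_def simp_thms)
qed

end
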